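(* Let $0<\gamma<\sqrt{3/8}$, and suppose that for some $s>0$ there is a saddle-saddle connection from $u_->0$ to $u_+$ for the system $$u'=v,\qquad v'=\frac{\gamma}{\sqrt{s}}\,v+u^3-u-(u_-^3-u_-)+s(u-u_-).$$ Then $$-\sqrt{\tfrac23\Bigl(1+\sqrt{1-\tfrac{8\gamma^2}{3}}\Bigr)}<u_+<-\sqrt{\tfrac23\Bigl(1-\sqrt{1-\tfrac{8\gamma^2}{3}}\Bigr)},$$ and there is exactly one value $a\in(\tfrac12,1)$ with $D(a,\gamma)\ge 0$ such that, for at least one choice of the sign $\pm$, $$u_+=-\left(\frac{1\pm\sqrt{D(a,\gamma)}}{2(1-a+a^2)}\right)^{1/2},$$ where $$D(a,\gamma)=1-\frac89\gamma^2\left(1+\frac{a}{(a-1)^2}\right);$$ moreover, for this value of $a$ (which is thus determined uniquely by $u_+$ and $\gamma$), $u_-=-a\,u_+$.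
   Context: Here $u_-,u_+\in\mathbb{R}$, $s>0$, and $'=d/d\xi$, $\xi\in\mathbb{R}$. The system arises from traveling waves $u(x-st)$ with $s>0$ of the PDE $u_t+(u-u^3)_x=\beta u_{xx}+\mu u_{xxt}$, $\beta,\mu>0$, with $\gamma=\beta/\sqrt{\mu}$ and $\xi=(x-st)/\sqrt{\mu s}$. An equilibrium of the system is a point $(u,0)$ with $u^3-u-(u_-^3-u_-)+s(u-u_-)=0$. An equilibrium is a saddle point if the Jacobian matrix of the vector field there has real eigenvalues of opposite (nonzero) sign. A saddle-saddle connection from $u_-$ to $u_+$ is a heteroclinic orbit from $(u_-,0)$ to $(u_+,0)$, i.e. a solution $(u,v)(\xi)$ defined for all $\xi\in\mathbb{R}$ with $(u,v)(\xi)\to(u_-,0)$ as $\xi\to-\infty$ and $(u,v)(\xi)\to(u_+,0)$ as $\xi\to+\infty$, where $(u_-,0)$ and $(u_+,0)$ are two distinct equilibria, both of which are saddle points. *)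

theory Defs
  imports "HOL-Analysis.Analysis"
begin

text \<open>
  The system arises from travelling waves \<open>u (x - s t)\<close> of
  \<open>u\<^sub>t + (u - u\<^sup>3)\<^sub>x = \<beta> u\<^sub>x\<^sub>x + \<mu> u\<^sub>x\<^sub>x\<^sub>t\<close>, with \<open>\<gamma> = \<beta> / sqrt \<mu>\<close> and \<open>\<xi> = (x - s t) / sqrt (\<mu> s)\<close>.
  The phase plane is \<^typ>\<open>real ^ 2\<close>, a point \<open>(u, v)\<close> being \<open>vector [u, v]\<close>.
  In what follows, \<open>um\<close> stands for \<open>u\<^sub>-\<close> and \<open>up\<close> for \<open>u\<^sub>+\<close>.
\<close>

definition wave_cubic :: "real \<Rightarrow> real \<Rightarrow> real \<Rightarrow> real" where
  "wave_cubic s um u = u ^ 3 - u - (um ^ 3 - um) + s * (u - um)"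

definition wave_field :: "real \<Rightarrow> real \<Rightarrow> real \<Rightarrow> real ^ 2 \<Rightarrow> real ^ 2" where
  "wave_field \<gamma> s um z = vector [z $ 2, \<gamma> / sqrt s * z $ 2 + wave_cubic s um (z $ 1)]"

definition equilibrium :: "real \<Rightarrow> real \<Rightarrow> real ^ 2 \<Rightarrow> bool" where
  "equilibrium s um z \<longleftrightarrow> z $ 2 = 0 \<and> wave_cubic s um (z $ 1) = 0"

definition real_eigenvalue :: "real ^ 'n ^ 'n \<Rightarrow> real \<Rightarrow> bool" where
  "real_eigenvalue A l \<longleftrightarrow> (\<exists>x. x \<noteq> 0 \<and> A *v x = l *\<^sub>R x)"

definition saddle_point :: "real \<Rightarrow> real \<Rightarrow> real \<Rightarrow> real ^ 2 \<Rightarrow> bool" where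
  "saddle_point \<gamma> s um z \<longleftrightarrow> equilibrium s um z \<and>
     (\<exists>l1 l2. real_eigenvalue (jacobian (wave_field \<gamma> s um) (at z)) l1 \<and>
              real_eigenvalue (jacobian (wave_field \<gamma> s um) (at z)) l2 \<and> l1 < 0 \<and> 0 < l2)"

definition heteroclinic_orbit ::
  "real \<Rightarrow> real \<Rightarrow> real \<Rightarrow> (real \<Rightarrow> real ^ 2) \<Rightarrow> real ^ 2 \<Rightarrow> real ^ 2 \<Rightarrow> bool" where
  "heteroclinic_orbit \<gamma> s um z p q \<longleftrightarrow>
     p \<noteq> q \<and> equilibrium s um p \<and> equilibrium s um q \<and>
     (\<forall>\<xi>. (z has_vector_derivative wave_field \<gamma> s um (z \<xi>)) (at \<xi>)) \<and>
     (z \<longlongrightarrow> p) at_bot \<and> (z \<longlongrightarrow> q) at_top"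

definition saddle_saddle_connection :: "real \<Rightarrow> real \<Rightarrow> real \<Rightarrow> real \<Rightarrow> bool" where
  "saddle_saddle_connection \<gamma> s um up \<longleftrightarrow>
     saddle_point \<gamma> s um (vector [um, 0]) \<and> saddle_point \<gamma> s um (vector [up, 0]) \<and>
     (\<exists>z. heteroclinic_orbit \<gamma> s um z (vector [um, 0]) (vector [up, 0]))"

definition D :: "real \<Rightarrow> real \<Rightarrow> real" where
  "D a \<gamma> = 1 - 8 / 9 * \<gamma>\<^sup>2 * (1 + a / (a - 1)\<^sup>2)"

text \<open>The sign \<open>\<sigma>\<close> is \<open>1\<close> or \<open>- 1\<close>; at least one of the two has to give \<open>u\<^sub>+\<close>.\<close>

definition admissible_ratio :: "real \<Rightarrow> real \<Rightarrow> real \<Rightarrow> bool" where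
  "admissible_ratio \<gamma> up a \<longleftrightarrow> 1 / 2 < a \<and> a < 1 \<and> 0 \<le> D a \<gamma> \<and>
     (\<exists>\<sigma>\<in>{1, - 1}. up = - sqrt ((1 + \<sigma> * sqrt (D a \<gamma>)) / (2 * (1 - a + a\<^sup>2))))"

end

theory Submission
  imports Defs
begin

text \<open>
  Write \<open>p = u\<^sub>-\<close>, \<open>q = u\<^sub>+\<close>, \<open>\<theta> = \<gamma> / sqrt s\<close>. The cubic has the roots \<open>p\<close>, \<open>q\<close> and
  \<open>r = - p - q\<close>, and at a saddle its derivative is positive, so \<open>p\<close> and \<open>q\<close> are the outer roots.
  With \<open>p > 0\<close> this leaves only \<open>q < r < p\<close>.

  The heart of the proof (\<open>saddle_saddle_friction\<close>) is that an orbit joining the two outer roots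
  forces one particular value of \<open>\<theta>\<close>. When \<open>\<theta>\<close> has that value the parabola
  \<open>v = c (u - p) (u - q)\<close> with \<open>c = 1 / sqrt 2\<close> is invariant. For general \<open>\<theta>\<close>, the signed distance
  \<open>w = v - c (u - p) (u - q)\<close> of an orbit from the parabola obeys
  \<open>w' = (\<theta> - c (2 u - p - q)) w + K (u - p) (u - q)\<close>,
  where \<open>K = c \<theta> - r + (p + q) / 2\<close> is a constant. The orbit stays in \<open>q \<le> u \<le> p\<close>, so after
  multiplication by an integrating factor \<open>w\<close> becomes a monotone function \<open>g\<close>. The parabola joins
  the two saddles as well, hence \<open>w\<close> is small at both ends, small enough that \<open>g\<close> tends to zero at
  both. Thus \<open>g = 0\<close> and therefore \<open>K = 0\<close>. Smallness at \<open>- \<infinity>\<close> rests on the estimate that \<open>v\<close> and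
  \<open>u - p\<close> are there at most of order \<open>exp (\<theta> \<xi>)\<close> (\<open>departure_rate\<close>).

  With \<open>q = - sqrt Y\<close>, \<open>p = a sqrt Y\<close>, the equation \<open>K = 0\<close> together with
  \<open>s = 1 - (p\<^sup>2 + p q + q\<^sup>2) = 1 - Y (1 - a + a\<^sup>2)\<close> reads
  \<open>\<gamma>\<^sup>2 = 9/2 Y (1 - a)\<^sup>2 (1 - Y (1 - a + a\<^sup>2))\<close>.
  Moreover \<open>K = 0\<close> makes \<open>r\<close> a positive multiple of \<open>\<theta>\<close>, and \<open>0 < r < p\<close> reads \<open>1 / 2 < a < 1\<close>.
  The equation for \<open>\<gamma>\<^sup>2\<close> is quadratic in \<open>Y\<close>, and its solution is the formula with \<open>D a \<gamma>\<close>
  (\<open>admissible_ratio_iff\<close>). For fixed \<open>Y\<close> its right-hand side is strictly decreasing in \<open>a\<close> as long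
  as the last factor, which is \<open>s\<close>, is positive. This gives uniqueness of \<open>a\<close>, and comparison with
  the value at \<open>a = 1 / 2\<close> gives the bounds on \<open>u\<^sub>+\<close>.
\<close>

section \<open>Real functions with prescribed behaviour at infinity\<close>

text \<open>
  A maximum principle: if \<open>u\<close> exceeded \<open>M\<close>, it would attain a global maximum above \<open>M\<close>, because
  both limits are at most \<open>M\<close>; there \<open>u' = 0\<close> and \<open>u'' > 0\<close>, which is impossible.
\<close>

lemma le_of_limits_le_and_convex_above:
  fixes u v w :: "real \<Rightarrow> real"
  assumes du: "\<And>x. (u has_real_derivative v x) (at x)"
    and dv: "\<And>x. (v has_real_derivative w x) (at x)"
    and bot: "(u \<longlongrightarrow> a) at_bot" and top: "(u \<longlongrightarrow> b) at_top"
    and "a \<le> M" "b \<le> M"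
    and pos: "\<And>x. M < u x \<Longrightarrow> v x = 0 \<Longrightarrow> 0 < w x"
  shows "u x \<le> M"
proof (rule ccontr)
  assume "\<not> u x \<le> M"
  then have x: "M < u x" by simp
  have "\<forall>\<^sub>F y in at_bot. u y < u x"
    using x \<open>a \<le> M\<close> by (intro order_tendstoD(2)[OF bot]) auto
  then obtain l where l: "\<And>y. y \<le> l \<Longrightarrow> u y < u x"
    by (auto simp: eventually_at_bot_linorder)
  have "\<forall>\<^sub>F y in at_top. u y < u x"
    using x \<open>b \<le> M\<close> by (intro order_tendstoD(2)[OF top]) auto
  then obtain k where k: "\<And>y. k \<le> y \<Longrightarrow> u y < u x"
    by (auto simp: eventually_at_top_linorder)
  have lx: "l < x" using l[of x] by (meson less_irrefl not_le)
  have xk: "x < k" using k[of x] by (meson less_irrefl not_le)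
  have "continuous_on {l..k} u"
    using du by (intro continuous_at_imp_continuous_on) (auto intro: DERIV_isCont)
  with lx xk obtain m where m: "m \<in> {l..k}" "\<And>y. y \<in> {l..k} \<Longrightarrow> u y \<le> u m"
    using continuous_attains_sup[of "{l..k}" u] by auto
  have "u x \<le> u m" using m(2)[of x] lx xk by simp
  have max: "u y \<le> u m" for y
  proof (cases "y \<in> {l..k}")
    case False
    then have "u y < u x" using l[of y] k[of y] by force
    with \<open>u x \<le> u m\<close> show ?thesis by simp
  qed (rule m(2))
  have "v m = 0"
    using DERIV_local_max[OF du, of 1 m] max by simp
  moreover have "M < u m" using x \<open>u x \<le> u m\<close> by simp
  ultimately have "0 < w m" using pos by blast
  then obtain d where d: "0 < d" "\<And>h. 0 < h \<Longrightarrow> h < d \<Longrightarrow> v m < v (m + h)"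
    using DERIV_pos_inc_right[OF dv, of m] by blast
  have "u m < u (m + d/2)"
  proof (rule DERIV_pos_imp_increasing_open[of m "m + d/2" u])
    show "m < m + d/2" using d by simp
    show "\<exists>y. (u has_real_derivative y) (at z) \<and> y > 0" if "m < z" "z < m + d/2" for z
      using d(2)[of "z - m"] that \<open>v m = 0\<close> du[of z] by auto
    show "continuous_on {m..m + d/2} u"
      using du by (intro continuous_at_imp_continuous_on) (auto intro: DERIV_isCont)
  qed
  with max[of "m + d/2"] show False by simp
qed

lemma filterlim_at_bot_of_deriv_tendsto_pos:
  fixes G G' :: "real \<Rightarrow> real"
  assumes dG: "\<And>x. (G has_real_derivative G' x) (at x)"
    and lim: "(G' \<longlongrightarrow> L) at_bot" and "0 < L"
  shows "filterlim G at_bot at_bot"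
proof -
  have "\<forall>\<^sub>F x in at_bot. L/2 < G' x"
    using lim \<open>0 < L\<close> by (intro order_tendstoD(1)) auto
  then obtain T where T: "\<And>x. x \<le> T \<Longrightarrow> L/2 < G' x"
    by (auto simp: eventually_at_bot_linorder)
  have bound: "G x \<le> G T - L/2 * T + L/2 * x" if "x \<le> T" for x
  proof -
    have "G x - L/2 * x \<le> G T - L/2 * T"
    proof (rule DERIV_nonneg_imp_nondecreasing[OF that])
      fix y assume "x \<le> y" "y \<le> T"
      show "\<exists>z. ((\<lambda>x. G x - L/2 * x) has_real_derivative z) (at y) \<and> 0 \<le> z"
        using T[OF \<open>y \<le> T\<close>] by (intro exI conjI) (auto intro!: derivative_eq_intros dG)
    qed
    then show ?thesis by simp
  qed
  show ?thesis
    unfolding filterlim_at_bot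
  proof
    fix Z
    show "\<forall>\<^sub>F x in at_bot. G x \<le> Z"
      using eventually_le_at_bot[of T] eventually_le_at_bot[of "(Z - (G T - L/2 * T)) / (L/2)"]
    proof eventually_elim
      case (elim x)
      then have "L/2 * x \<le> Z - (G T - L/2 * T)"
        using \<open>0 < L\<close> by (simp add: pos_le_divide_eq mult.commute)
      with bound[OF elim(1)] show ?case by simp
    qed
  qed
qed

lemma filterlim_at_bot_of_deriv_tendsto_neg:
  fixes G G' :: "real \<Rightarrow> real"
  assumes dG: "\<And>x. (G has_real_derivative G' x) (at x)"
    and lim: "(G' \<longlongrightarrow> L) at_top" and "L < 0"
  shows "filterlim G at_bot at_top"
proof -
  have "filterlim (\<lambda>x. G (- x)) at_bot at_bot"
  proof (rule filterlim_at_bot_of_deriv_tendsto_pos)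
    show "((\<lambda>x. G (- x)) has_real_derivative - G' (- x)) (at x)" for x
      using DERIV_chain'[OF DERIV_minus[OF DERIV_ident] dG, of x UNIV] by simp
    show "((\<lambda>x. - G' (- x)) \<longlongrightarrow> - L) at_bot"
      using lim by (intro tendsto_minus) (simp add: filterlim_at_top_mirror)
    show "0 < - L" using \<open>L < 0\<close> by simp
  qed
  then show ?thesis by (simp add: filterlim_at_top_mirror)
qed

lemma eq_zero_of_deriv_nonneg_of_limits_zero:
  fixes g g' :: "real \<Rightarrow> real"
  assumes dg: "\<And>x. (g has_real_derivative g' x) (at x)"
    and nonneg: "\<And>x. 0 \<le> g' x"
    and bot: "(g \<longlongrightarrow> 0) at_bot" and top: "(g \<longlongrightarrow> 0) at_top"
  shows "g x = 0"
proof -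
  have mono: "g y \<le> g z" if "y \<le> z" for y z
    using that by (rule DERIV_nonneg_imp_nondecreasing) (use dg nonneg in blast)
  have "0 \<le> g x"
    using bot by (rule tendsto_upperbound)
      (auto intro: eventually_mono[OF eventually_le_at_bot[of x] mono])
  moreover have "g x \<le> 0"
    using top by (rule tendsto_lowerbound)
      (auto intro: eventually_mono[OF eventually_ge_at_top[of x] mono])
  ultimately show ?thesis by simp
qed

section \<open>Friction of an orbit joining the outer roots\<close>

text \<open>
  Since \<open>(v exp (- \<theta> x))' = h exp (- \<theta> x) \<le> 0\<close> near \<open>- \<infinity>\<close>, the function \<open>v exp (- \<theta> x)\<close> grows as
  \<open>x\<close> decreases. It stays non-positive, because otherwise \<open>u\<close> would increase from its limit \<open>p\<close> and
  leave \<open>u \<le> p\<close>. So it is bounded; integrating \<open>v\<close> from \<open>- \<infinity>\<close> bounds \<open>p - u\<close>.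
\<close>

lemma departure_rate:
  fixes u v h :: "real \<Rightarrow> real"
  assumes "0 < \<theta>"
    and du: "\<And>x. (u has_real_derivative v x) (at x)"
    and dv: "\<And>x. (v has_real_derivative \<theta> * v x + h x) (at x)"
    and h: "\<forall>\<^sub>F x in at_bot. h x \<le> 0"
    and le: "\<And>x. u x \<le> p"
    and lim: "(u \<longlongrightarrow> p) at_bot"
  obtains C where "0 \<le> C"
    "\<forall>\<^sub>F x in at_bot. \<bar>v x\<bar> \<le> C * exp (\<theta> * x) \<and> \<bar>u x - p\<bar> \<le> C / \<theta> * exp (\<theta> * x)"
proof -
  obtain T where T: "\<And>x. x \<le> T \<Longrightarrow> h x \<le> 0"
    using h by (auto simp: eventually_at_bot_linorder)
  define k where "k = (\<lambda>x. v x * exp (- \<theta> * x))"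
  have v_eq: "v x = k x * exp (\<theta> * x)" for x
    by (simp add: k_def mult.assoc flip: exp_add)
  have dk: "(k has_real_derivative h x * exp (- \<theta> * x)) (at x)" for x
    unfolding k_def by (rule derivative_eq_intros dv refl | simp add: algebra_simps)+
  have anti: "k y \<le> k x" if "x \<le> y" "y \<le> T" for x y
    using \<open>x \<le> y\<close>
  proof (rule DERIV_nonpos_imp_nonincreasing)
    fix z assume "x \<le> z" "z \<le> y"
    with T[of z] \<open>y \<le> T\<close> dk[of z]
    show "\<exists>d. (k has_real_derivative d) (at z) \<and> d \<le> 0"
      by (auto simp: mult_le_0_iff)
  qed
  have nonpos: "k x \<le> 0" if "x \<le> T" for x
  proof (rule ccontr)
    assume "\<not> k x \<le> 0"
    then have vpos: "0 < v y" if "y \<le> x" for y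
      using anti[OF that \<open>x \<le> T\<close>] by (simp add: v_eq)
    have mono: "u z < u y" if "z < y" "y \<le> x" for y z
      using \<open>z < y\<close>
      by (rule DERIV_pos_imp_increasing) (use du vpos \<open>y \<le> x\<close> in \<open>meson order_trans\<close>)
    have "p \<le> u (x - 1)"
      using lim
    proof (rule tendsto_upperbound)
      show "\<forall>\<^sub>F z in at_bot. u z \<le> u (x - 1)"
        using eventually_gt_at_bot[of "x - 1"]
        by (rule eventually_mono) (simp add: less_imp_le mono)
    qed simp
    also have "\<dots> < u x" using mono[of "x - 1" x] by simp
    finally show False using le[of x] by simp
  qed
  define C where "C = - k T"
  have "0 \<le> C" using nonpos[of T] by (simp add: C_def)
  have v_bd: "\<bar>v x\<bar> \<le> C * exp (\<theta> * x)" if "x \<le> T" for x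
    using anti[OF that order_refl] nonpos[OF that]
    by (simp add: v_eq abs_mult C_def)
  have u_bd: "\<bar>u x - p\<bar> \<le> C / \<theta> * exp (\<theta> * x)" if "x \<le> T" for x
  proof -
    define j where "j = (\<lambda>x. u x + C / \<theta> * exp (\<theta> * x))"
    have dj: "(j has_real_derivative v x + C * exp (\<theta> * x)) (at x)" for x
      unfolding j_def using \<open>0 < \<theta>\<close> by (auto intro!: derivative_eq_intros du)
    have mono: "j y \<le> j x" if "y \<le> x" for y
      using that
    proof (rule DERIV_nonneg_imp_nondecreasing)
      fix z assume "y \<le> z" "z \<le> x"
      then show "\<exists>d. (j has_real_derivative d) (at z) \<and> 0 \<le> d"
        using v_bd[of z] \<open>x \<le> T\<close> by (intro exI[of _ "v z + C * exp (\<theta> * z)"] conjI dj) auto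
    qed
    have "filterlim (\<lambda>x. \<theta> * x) at_bot at_bot"
      using \<open>0 < \<theta>\<close> by (intro filterlim_tendsto_pos_mult_at_bot[OF tendsto_const] filterlim_ident)
    then have "((\<lambda>x. exp (\<theta> * x)) \<longlongrightarrow> 0) at_bot"
      by (rule filterlim_compose[OF exp_at_bot])
    then have "(j \<longlongrightarrow> p) at_bot"
      unfolding j_def using tendsto_add[OF lim tendsto_mult_right_zero, of _ "C / \<theta>"] by simp
    then have "p \<le> j x"
      by (rule tendsto_upperbound) (auto intro: eventually_mono[OF eventually_le_at_bot[of x] mono])
    with le[of x] show ?thesis by (simp add: j_def)
  qed
  show ?thesis
    using \<open>0 \<le> C\<close>
  proof (rule that)
    show "\<forall>\<^sub>F x in at_bot. \<bar>v x\<bar> \<le> C * exp (\<theta> * x) \<and> \<bar>u x - p\<bar> \<le> C / \<theta> * exp (\<theta> * x)"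
      using eventually_le_at_bot[of T] by (rule eventually_mono) (rule conjI[OF v_bd u_bd])
  qed
qed

text \<open>
  Here \<open>g = w exp (- \<theta> x) exp G\<close> is the distance to the parabola times the integrating factor.
  The point of splitting this factor is that \<open>G' = c (2 u - p - q)\<close> is positive near \<open>- \<infinity>\<close> and
  negative near \<open>+ \<infinity>\<close>, so that \<open>exp G\<close> vanishes at both ends, and \<open>g\<close> vanishes with it once
  \<open>w exp (- \<theta> x)\<close> is known to be bounded.
\<close>

theorem saddle_saddle_friction:
  fixes u v :: "real \<Rightarrow> real"
  assumes "0 < \<theta>" and "q < r" and "r < p"
    and du: "\<And>x. (u has_real_derivative v x) (at x)"
    and dv: "\<And>x. (v has_real_derivative \<theta> * v x + (u x - p) * (u x - q) * (u x - r)) (at x)"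
    and u_bot: "(u \<longlongrightarrow> p) at_bot" and u_top: "(u \<longlongrightarrow> q) at_top"
    and v_top: "(v \<longlongrightarrow> 0) at_top"
  shows "\<theta> = sqrt 2 * (r - (p + q) / 2)"
proof -
  have "q < p" using \<open>q < r\<close> \<open>r < p\<close> by simp
  have u_le: "u x \<le> p" for x
    by (rule le_of_limits_le_and_convex_above[OF du dv u_bot u_top])
      (use \<open>q < r\<close> \<open>r < p\<close> in \<open>auto intro!: mult_pos_pos\<close>)
  have "- u x \<le> - q" for x
  proof (rule le_of_limits_le_and_convex_above[where u = "\<lambda>x. - u x"])
    show "((\<lambda>x. - u x) has_real_derivative - v x) (at x)"
      "((\<lambda>x. - v x) has_real_derivative - (\<theta> * v x + (u x - p) * (u x - q) * (u x - r))) (at x)" for x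
      by (rule DERIV_minus du dv)+
    show "0 < - (\<theta> * v x + (u x - p) * (u x - q) * (u x - r))"
      if "- q < - u x" "- v x = 0" for x
      using that \<open>q < r\<close> \<open>r < p\<close> by (auto intro!: mult_pos_neg mult_neg_neg)
  qed (use u_bot u_top \<open>q < p\<close> in \<open>auto intro: tendsto_minus\<close>)
  then have u_ge: "q \<le> u x" for x by simp

  \<comment> \<open>The sign of \<open>c\<close> is the one for which the parabola is traversed from \<open>p\<close> down to \<open>q\<close>; its size
    is the one for which the inhomogeneous term in the equation for \<open>w\<close> is a constant multiple of
    \<open>(u - p) (u - q)\<close>.\<close>
  define c :: real where "c = 1 / sqrt 2"
  have c: "0 < c" "c * c = 1 / 2" by (auto simp: c_def)
  define K where "K = c * \<theta> - r + (p + q) / 2"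
  define w where "w = (\<lambda>x. v x - c * (u x - p) * (u x - q))"
  have "\<exists>U. \<forall>x::real. -\<infinity> < ereal x \<longrightarrow> ereal x < \<infinity> \<longrightarrow> (U has_vector_derivative u x) (at x)"
    using DERIV_isCont[OF du] by (intro einterval_antiderivative) auto
  then obtain U where dU: "\<And>x. (U has_real_derivative u x) (at x)"
    by (auto simp: has_real_derivative_iff_has_vector_derivative)
  define G where "G = (\<lambda>x. c * (2 * U x - (p + q) * x))"
  have dG: "(G has_real_derivative c * (2 * u x - (p + q))) (at x)" for x
    unfolding G_def by (auto intro!: derivative_eq_intros dU)
  define g where "g = (\<lambda>x. w x * exp (- \<theta> * x) * exp (G x))"
  have dw: "(w has_real_derivative
      w x * (\<theta> - c * (2 * u x - (p + q))) + K * ((u x - p) * (u x - q))) (at x)" for x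
  proof -
    have "(w has_real_derivative \<theta> * v x + (u x - p) * (u x - q) * (u x - r)
        - (c * v x * (u x - q) + c * (u x - p) * v x)) (at x)"
      unfolding w_def by (auto intro!: derivative_eq_intros du dv)
    moreover have "\<theta> * v x + (u x - p) * (u x - q) * (u x - r)
        - (c * v x * (u x - q) + c * (u x - p) * v x)
      = w x * (\<theta> - c * (2 * u x - (p + q))) + K * ((u x - p) * (u x - q))"
      unfolding w_def K_def using c(2) by algebra
    ultimately show ?thesis by simp
  qed
  have dg: "(g has_real_derivative
      K * ((u x - p) * (u x - q)) * (exp (- \<theta> * x) * exp (G x))) (at x)" for x
    unfolding g_def by (rule derivative_eq_intros dw dG refl | simp add: algebra_simps)+

  have dG_bot: "((\<lambda>x. c * (2 * u x - (p + q))) \<longlongrightarrow> c * (2 * p - (p + q))) at_bot"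
    and dG_top: "((\<lambda>x. c * (2 * u x - (p + q))) \<longlongrightarrow> c * (2 * q - (p + q))) at_top"
    by (intro tendsto_intros u_bot u_top)+
  have G_bot: "filterlim G at_bot at_bot"
    by (rule filterlim_at_bot_of_deriv_tendsto_pos[OF dG dG_bot]) (use c \<open>q < p\<close> in simp)
  have G_top: "filterlim G at_bot at_top"
    by (rule filterlim_at_bot_of_deriv_tendsto_neg[OF dG dG_top])
      (use c \<open>q < p\<close> in \<open>simp add: mult_pos_neg\<close>)
  have E_bot: "((\<lambda>x. exp (G x)) \<longlongrightarrow> 0) at_bot" and E_top: "((\<lambda>x. exp (G x)) \<longlongrightarrow> 0) at_top"
    by (rule filterlim_compose[OF exp_at_bot] G_bot G_top)+

  have "\<forall>\<^sub>F x in at_bot. r < u x"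
    using u_bot \<open>r < p\<close> by (rule order_tendstoD)
  then have "\<forall>\<^sub>F x in at_bot. (u x - p) * (u x - q) * (u x - r) \<le> 0"
    by eventually_elim (use u_le u_ge in \<open>simp add: mult_le_0_iff\<close>)
  then obtain C where "0 \<le> C" and C:
    "\<forall>\<^sub>F x in at_bot. \<bar>v x\<bar> \<le> C * exp (\<theta> * x) \<and> \<bar>u x - p\<bar> \<le> C / \<theta> * exp (\<theta> * x)"
    using departure_rate[OF \<open>0 < \<theta>\<close> du dv _ u_le u_bot] by blast
  define B where "B = C + c * (C / \<theta>) * (p - q)"
  have g_bot: "(g \<longlongrightarrow> 0) at_bot"
  proof (rule Lim_null_comparison)
    show "((\<lambda>x. B * exp (G x)) \<longlongrightarrow> 0) at_bot"
      using tendsto_mult_right_zero[OF E_bot] .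
    show "\<forall>\<^sub>F x in at_bot. norm (g x) \<le> B * exp (G x)"
      using C
    proof eventually_elim
      case (elim x)
      have "\<bar>w x\<bar> \<le> \<bar>v x\<bar> + \<bar>c * (u x - p) * (u x - q)\<bar>"
        unfolding w_def by linarith
      also have "\<bar>c * (u x - p) * (u x - q)\<bar> = c * \<bar>u x - p\<bar> * (u x - q)"
        using c u_ge[of x] by (simp add: abs_mult)
      also have "\<dots> \<le> c * (C / \<theta> * exp (\<theta> * x)) * (p - q)"
        using elim c u_le[of x] u_ge[of x] \<open>0 \<le> C\<close> \<open>0 < \<theta>\<close>
        by (intro mult_mono mult_left_mono) auto
      also have "\<bar>v x\<bar> \<le> C * exp (\<theta> * x)" using elim by simp
      finally have "\<bar>w x\<bar> \<le> B * exp (\<theta> * x)" by (simp add: B_def algebra_simps)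
      then have "\<bar>w x\<bar> * exp (- \<theta> * x) \<le> B * exp (\<theta> * x) * exp (- \<theta> * x)"
        by (intro mult_right_mono) auto
      also have "\<dots> = B" by (simp add: mult.assoc flip: exp_add)
      finally show ?case by (simp add: g_def abs_mult)
    qed
  qed
  have g_top: "(g \<longlongrightarrow> 0) at_top"
  proof (rule Lim_null_comparison)
    have "(w \<longlongrightarrow> 0 - c * (q - p) * (q - q)) at_top"
      unfolding w_def by (intro tendsto_intros u_top v_top)
    from tendsto_mult[OF tendsto_rabs[OF this] E_top]
    show "((\<lambda>x. \<bar>w x\<bar> * exp (G x)) \<longlongrightarrow> 0) at_top" by simp
    show "\<forall>\<^sub>F x in at_top. norm (g x) \<le> \<bar>w x\<bar> * exp (G x)"
      using eventually_ge_at_top[of 0]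
    proof eventually_elim
      case (elim x)
      then have "exp (- \<theta> * x) \<le> 1" using \<open>0 < \<theta>\<close> by simp
      then have "\<bar>w x\<bar> * exp (- \<theta> * x) \<le> \<bar>w x\<bar>" by (intro mult_left_le) auto
      then have "\<bar>w x\<bar> * exp (- \<theta> * x) * exp (G x) \<le> \<bar>w x\<bar> * exp (G x)"
        by (rule mult_right_mono) simp
      then show ?case by (simp add: g_def abs_mult)
    qed
  qed
  have between: "(u x - p) * (u x - q) \<le> 0" for x
    using u_le[of x] u_ge[of x] by (simp add: mult_le_0_iff)
  have "\<exists>x. u x = (p + q) / 2"
  proof -
    have "\<forall>\<^sub>F x in at_bot. (p + q) / 2 < u x"
      using u_bot \<open>q < p\<close> by (intro order_tendstoD(1)) auto
    then obtain a where a: "\<And>x. x \<le> a \<Longrightarrow> (p + q) / 2 < u x"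
      by (auto simp: eventually_at_bot_linorder)
    have "\<forall>\<^sub>F x in at_top. u x < (p + q) / 2"
      using u_top \<open>q < p\<close> by (intro order_tendstoD(2)) auto
    then obtain b where b: "\<And>x. b \<le> x \<Longrightarrow> u x < (p + q) / 2"
      by (auto simp: eventually_at_top_linorder)
    have "\<exists>x\<ge>min a b. x \<le> max a b \<and> u x = (p + q) / 2"
    proof (rule IVT2)
      show "u (max a b) \<le> (p + q) / 2" "(p + q) / 2 \<le> u (min a b)"
        using a[of "min a b"] b[of "max a b"] by simp_all
    qed (simp_all add: DERIV_isCont[OF du])
    then show ?thesis by blast
  qed
  then obtain m where "u m = (p + q) / 2" ..
  then have m: "(u m - p) * (u m - q) < 0"
    using \<open>q < p\<close> by (simp add: mult_less_0_iff)
  \<comment> \<open>The derivative of \<open>g\<close> has the sign of \<open>- K\<close> throughout, whichever it is.\<close>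
  define P where "P = (\<lambda>x. (u x - p) * (u x - q) * (exp (- \<theta> * x) * exp (G x)))"
  have P_le: "P x \<le> 0" for x
    unfolding P_def by (rule mult_nonpos_nonneg[OF between]) simp
  have dg': "(g has_real_derivative K * P x) (at x)" for x
    using dg[of x] by (simp add: P_def mult.assoc)
  have g_zero: "g x = 0" for x
  proof (cases "0 \<le> K")
    case True
    have "- g x = 0"
      using DERIV_minus[OF dg'] _ tendsto_minus[OF g_bot, simplified]
        tendsto_minus[OF g_top, simplified]
    proof (rule eq_zero_of_deriv_nonneg_of_limits_zero)
      show "0 \<le> - (K * P y)" for y
        using mult_nonneg_nonpos[OF True P_le] by simp
    qed
    then show ?thesis by simp
  next
    case False
    then show ?thesis
      using P_le
      by (intro eq_zero_of_deriv_nonneg_of_limits_zero[OF dg' _ g_bot g_top]) (simp add: mult_nonpos_nonpos)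
  qed
  have "g = (\<lambda>x. 0)" using g_zero by auto
  then have "(g has_real_derivative 0) (at m)" by simp
  then have "K * P m = 0" using dg' DERIV_unique by blast
  moreover have "P m < 0" unfolding P_def using m by (simp add: mult_less_0_iff)
  ultimately have "K = 0" by simp
  then have "c * \<theta> = r - (p + q) / 2" by (simp add: K_def)
  moreover have "sqrt 2 * c = 1" by (simp add: c_def)
  then have "sqrt 2 * (c * \<theta>) = \<theta>" by (simp flip: mult.assoc)
  ultimately show ?thesis by simp
qed

section \<open>Saddles and connections of the wave system\<close>

lemma wave_cubic_factor:
  assumes "wave_cubic s p q = 0" and "p \<noteq> q"
  shows "s = 1 - (p\<^sup>2 + p * q + q\<^sup>2)"
    and "wave_cubic s p u = (u - p) * (u - q) * (u + p + q)"
proof -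
  have "(q - p) * (s - (1 - (p\<^sup>2 + p * q + q\<^sup>2))) = wave_cubic s p q"
    by (simp add: wave_cubic_def algebra_simps power2_eq_square power3_eq_cube)
  with assms show s: "s = 1 - (p\<^sup>2 + p * q + q\<^sup>2)" by simp
  show "wave_cubic s p u = (u - p) * (u - q) * (u + p + q)"
    unfolding s wave_cubic_def by (simp add: algebra_simps power2_eq_square power3_eq_cube)
qed

text \<open>
  The quantity \<open>3 u\<^sup>2 - 1 + s\<close> is the derivative of the cubic at \<open>u\<close>, that is, minus the determinant of the
  Jacobian matrix, hence minus the product of the two eigenvalues.
\<close>

lemma saddle_point_slope_pos:
  assumes "saddle_point \<gamma> s um (vector [u, 0])"
  shows "0 < 3 * u\<^sup>2 - 1 + s"
proof -
  define z :: "real ^ 2" where "z = vector [u, 0]"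
  define \<theta> where "\<theta> = \<gamma> / sqrt s"
  define d where "d = 3 * u\<^sup>2 - 1 + s"
  have eq: "wave_field \<gamma> s um = (\<lambda>z. (z $ 2) *\<^sub>R axis 1 1
      + (\<theta> * z $ 2 + wave_cubic s um (z $ 1)) *\<^sub>R axis 2 1)"
    by (auto simp: wave_field_def vec_eq_iff forall_2 axis_def \<theta>_def)
  have der: "(wave_field \<gamma> s um has_derivative
      (\<lambda>h. (h $ 2) *\<^sub>R axis 1 1 + (\<theta> * h $ 2 + d * h $ 1) *\<^sub>R axis 2 1)) (at z)"
    unfolding eq wave_cubic_def d_def
    by (auto intro!: derivative_eq_intros bounded_linear_imp_has_derivative[OF bounded_linear_vec_nth]
        simp: z_def algebra_simps)
  then have "wave_field \<gamma> s um differentiable (at z)"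
    by (auto simp: differentiable_def)
  then have "(wave_field \<gamma> s um has_derivative (\<lambda>h. jacobian (wave_field \<gamma> s um) (at z) *v h)) (at z)"
    by (simp add: jacobian_works)
  then have J: "(\<lambda>h. jacobian (wave_field \<gamma> s um) (at z) *v h)
      = (\<lambda>h. (h $ 2) *\<^sub>R axis 1 1 + (\<theta> * h $ 2 + d * h $ 1) *\<^sub>R axis 2 1)"
    using der has_derivative_unique by blast
  have char: "l * l = \<theta> * l + d" if "real_eigenvalue (jacobian (wave_field \<gamma> s um) (at z)) l" for l
  proof -
    from that obtain x where "x \<noteq> 0"
      and x: "jacobian (wave_field \<gamma> s um) (at z) *v x = l *\<^sub>R x"
      by (auto simp: real_eigenvalue_def)
    have "(x $ 2) *\<^sub>R axis 1 1 + (\<theta> * x $ 2 + d * x $ 1) *\<^sub>R axis 2 1 = l *\<^sub>R x"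
      using x fun_cong[OF J, of x] by simp
    then have *: "x $ 2 = l * x $ 1" "\<theta> * x $ 2 + d * x $ 1 = l * x $ 2"
      by (auto simp: vec_eq_iff forall_2 axis_def)
    with \<open>x \<noteq> 0\<close> have "x $ 1 \<noteq> 0" by (auto simp: vec_eq_iff forall_2)
    moreover have "x $ 1 * (l * l) = x $ 1 * (\<theta> * l + d)"
      using * by (simp add: algebra_simps)
    ultimately show ?thesis by simp
  qed
  \<comment> \<open>Two distinct roots of the characteristic polynomial determine \<open>d\<close> as minus their product.\<close>
  obtain l1 l2 where l: "l1 * l1 = \<theta> * l1 + d" "l2 * l2 = \<theta> * l2 + d" "l1 < 0" "0 < l2"
    using assms char unfolding saddle_point_def z_def by blast
  have "(l2 - l1) * (d + l1 * l2) = 0" using l(1,2) by algebra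
  then have "d = - (l1 * l2)" using l(3,4) by simp
  moreover have "l1 * l2 < 0" using l(3,4) by (rule mult_neg_pos)
  ultimately show ?thesis by (simp add: d_def)
qed

text \<open>
  Positivity of the derivative at both saddles puts \<open>- um - up\<close> strictly between \<open>um\<close> and \<open>up\<close>. As
  this number has the opposite sign of \<open>um\<close> when \<open>up\<close> is positive, \<open>up\<close> must be the smallest root.
  The inequality \<open>up < - um\<close> then says that the middle root is positive, and that follows from the
  positivity of the friction, which is a positive multiple of it.
\<close>

lemma saddle_saddle_connection_relation:
  assumes "0 < \<gamma>" "0 < s" "0 < um" and conn: "saddle_saddle_connection \<gamma> s um up"
  shows "s = 1 - (um\<^sup>2 + um * up + up\<^sup>2)" and "up < - um" and "- up < 2 * um"
    and "\<gamma> / sqrt s = 3 / sqrt 2 * (- up - um)"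
proof -
  obtain z where saddles: "saddle_point \<gamma> s um (vector [um, 0])" "saddle_point \<gamma> s um (vector [up, 0])"
    and z: "heteroclinic_orbit \<gamma> s um z (vector [um, 0]) (vector [up, 0])"
    using conn by (auto simp: saddle_saddle_connection_def)
  have root: "wave_cubic s um up = 0" and "um \<noteq> up"
    using z by (auto simp: heteroclinic_orbit_def equilibrium_def)
  note f = wave_cubic_factor[OF root \<open>um \<noteq> up\<close>]
  show s: "s = 1 - (um\<^sup>2 + um * up + up\<^sup>2)" by (rule f)
  have "0 < (um - up) * (2 * um + up)" "0 < (up - um) * (2 * up + um)"
    using saddles[THEN saddle_point_slope_pos] unfolding s
    by (simp_all add: algebra_simps power2_eq_square)
  then have order: "up < - um - up" "- um - up < um"
    using \<open>0 < um\<close> by (auto simp: zero_less_mult_iff)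
  have "up < um" using order by simp
  define \<theta> where "\<theta> = \<gamma> / sqrt s"
  have "0 < \<theta>" using \<open>0 < \<gamma>\<close> \<open>0 < s\<close> by (simp add: \<theta>_def)
  have dz: "(z has_vector_derivative wave_field \<gamma> s um (z x)) (at x)" for x
    using z by (simp add: heteroclinic_orbit_def)
  have comp: "((\<lambda>x. z x $ i) has_real_derivative wave_field \<gamma> s um (z x) $ i) (at x)" for i x
    using bounded_linear.has_vector_derivative[OF bounded_linear_vec_nth dz]
    by (simp add: has_real_derivative_iff_has_vector_derivative)
  have lim: "((\<lambda>x. z x $ i) \<longlongrightarrow> vector [um, 0] $ i) at_bot"
    "((\<lambda>x. z x $ i) \<longlongrightarrow> vector [up, 0] $ i) at_top" for i
    using z by (auto simp: heteroclinic_orbit_def intro: tendsto_vec_nth)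
  have "\<theta> = sqrt 2 * ((- um - up) - (um + up) / 2)"
  proof (rule saddle_saddle_friction[OF \<open>0 < \<theta>\<close> order])
    show "((\<lambda>x. z x $ 1) has_real_derivative z x $ 2) (at x)" for x
      using comp[of 1 x] by (simp add: wave_field_def)
    show "((\<lambda>x. z x $ 2) has_real_derivative \<theta> * z x $ 2
        + (z x $ 1 - um) * (z x $ 1 - up) * (z x $ 1 - (- um - up))) (at x)" for x
    proof -
      have "z x $ 1 - (- um - up) = z x $ 1 + um + up" by simp
      with comp[of 2 x] show ?thesis by (simp only: wave_field_def f(2) \<theta>_def vector_2)
    qed
  qed (use lim[of 1] lim(2)[of 2] in simp_all)
  then have "\<theta> * sqrt 2 = sqrt 2 * sqrt 2 * ((- um - up) - (um + up) / 2)"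
    by (simp only: mult_ac)
  also have "\<dots> = 3 * (- up - um)" unfolding real_sqrt_mult_self by (simp add: field_simps)
  finally have friction: "\<theta> * sqrt 2 = 3 * (- up - um)" .
  then show "\<gamma> / sqrt s = 3 / sqrt 2 * (- up - um)"
    unfolding \<theta>_def[symmetric] by (simp add: eq_divide_eq)
  have "0 < \<theta> * sqrt 2" using \<open>0 < \<theta>\<close> by simp
  then show "up < - um" unfolding friction by simp
  show "- up < 2 * um" using order by simp
qed

section \<open>Ratio of the two end states\<close>

text \<open>
  Up to the factor \<open>9 Y / 2\<close> this is the value of \<open>\<gamma>\<^sup>2\<close> for a connection with \<open>up\<^sup>2 = Y\<close> and
  \<open>um = - a up\<close>; the first factor is then the speed \<open>s\<close>.
\<close>

definition ratio_fun :: "real \<Rightarrow> real \<Rightarrow> real" where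
  "ratio_fun Y a = (1 - Y * (1 - a + a\<^sup>2)) * (1 - a)\<^sup>2"

text \<open>
  Both factors decrease in \<open>a\<close> on \<open>[1/2, 1)\<close>, and both are still positive at the larger argument.
\<close>

lemma ratio_fun_less:
  assumes "0 < Y" "1 / 2 \<le> a" "a < b" "b < 1" "Y * (1 - b + b\<^sup>2) < 1"
  shows "ratio_fun Y b < ratio_fun Y a"
  unfolding ratio_fun_def
proof (rule mult_strict_mono')
  have "(b - a) * (a + b - 1) > 0" using assms by simp
  then have "1 - a + a\<^sup>2 < 1 - b + b\<^sup>2" by (simp add: algebra_simps power2_eq_square)
  with \<open>0 < Y\<close> show "1 - Y * (1 - b + b\<^sup>2) < 1 - Y * (1 - a + a\<^sup>2)" by simp
  show "(1 - b)\<^sup>2 < (1 - a)\<^sup>2" using assms by (intro power_strict_mono) auto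
qed (use assms in auto)

text \<open>
  The left equation is quadratic in \<open>Y\<close>, and \<open>D a \<gamma>\<close> is its normalized discriminant: with
  \<open>X = Y (1 - a + a\<^sup>2)\<close> it reads \<open>4 X (1 - X) = 1 - D a \<gamma>\<close>.
\<close>

lemma ratio_fun_eq_iff:
  assumes "a < 1"
  shows "\<gamma>\<^sup>2 = 9 / 2 * Y * ratio_fun Y a \<longleftrightarrow> D a \<gamma> = (2 * (Y * (1 - a + a\<^sup>2)) - 1)\<^sup>2"
proof -
  have ne: "(1 - a)\<^sup>2 \<noteq> 0" using assms by simp
  have "(1 - a)\<^sup>2 * (1 - D a \<gamma>) = 8 / 9 * \<gamma>\<^sup>2 * ((1 - a)\<^sup>2 + a)"
    using ne by (simp add: D_def power2_commute[of a 1] field_simps)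
  also have "(1 - a)\<^sup>2 + a = 1 - a + a\<^sup>2" by (simp add: power2_eq_square algebra_simps)
  finally have D: "(1 - a)\<^sup>2 * (1 - D a \<gamma>) = 8 / 9 * \<gamma>\<^sup>2 * (1 - a + a\<^sup>2)" .
  have pos: "1 - a + a\<^sup>2 > 0" using assms by (simp add: add_pos_nonneg)
  have cancel: "x = y \<longleftrightarrow> 8 / 9 * x * e = 8 / 9 * y * e" if "e \<noteq> 0" for x y e :: real
    using that by simp
  have "\<gamma>\<^sup>2 = 9 / 2 * Y * ratio_fun Y a \<longleftrightarrow>
      8 / 9 * \<gamma>\<^sup>2 * (1 - a + a\<^sup>2) = 8 / 9 * (9 / 2 * Y * ratio_fun Y a) * (1 - a + a\<^sup>2)"
    by (rule cancel) (use pos in simp)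
  also have "\<dots> \<longleftrightarrow> (1 - a)\<^sup>2 * (1 - D a \<gamma>) = (1 - a)\<^sup>2 * (1 - (2 * (Y * (1 - a + a\<^sup>2)) - 1)\<^sup>2)"
    unfolding D ratio_fun_def by (simp add: algebra_simps power2_eq_square)
  also have "\<dots> \<longleftrightarrow> D a \<gamma> = (2 * (Y * (1 - a + a\<^sup>2)) - 1)\<^sup>2" using ne by auto
  finally show ?thesis .
qed

text \<open>
  The two signs in the definition are the two roots of the quadratic equation. The condition
  \<open>up\<^sup>2 * (1 - a + a\<^sup>2) < 1\<close>, which is \<open>s > 0\<close>, comes for free from the closed formula because
  \<open>D a \<gamma> < 1\<close>.
\<close>

lemma admissible_ratio_iff:
  assumes "0 < \<gamma>"
  shows "admissible_ratio \<gamma> up a \<longleftrightarrow> up < 0 \<and> 1 / 2 < a \<and> a < 1 \<and>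
    up\<^sup>2 * (1 - a + a\<^sup>2) < 1 \<and> \<gamma>\<^sup>2 = 9 / 2 * up\<^sup>2 * ratio_fun (up\<^sup>2) a"
    (is "_ \<longleftrightarrow> ?R")
proof (cases "1 / 2 < a \<and> a < 1")
  case True
  define e where "e = 1 - a + a\<^sup>2"
  have e: "0 < e" using True by (simp add: e_def add_pos_nonneg)
  have "0 < 8 / 9 * \<gamma>\<^sup>2 * (1 + a / (a - 1)\<^sup>2)"
    using True \<open>0 < \<gamma>\<close> by (intro mult_pos_pos add_pos_nonneg) auto
  then have D_less: "D a \<gamma> < 1" by (simp add: D_def)
  have iff: "?R \<longleftrightarrow> up < 0 \<and> up\<^sup>2 * e < 1 \<and> D a \<gamma> = (2 * (up\<^sup>2 * e) - 1)\<^sup>2"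
    using True ratio_fun_eq_iff[of a \<gamma> "up\<^sup>2"] by (simp add: e_def)
  show ?thesis
  proof
    assume "admissible_ratio \<gamma> up a"
    then obtain \<sigma> where D: "0 \<le> D a \<gamma>" and \<sigma>: "\<sigma> \<in> {1, - 1}"
      and up: "up = - sqrt ((1 + \<sigma> * sqrt (D a \<gamma>)) / (2 * e))"
      unfolding admissible_ratio_def e_def by blast
    have "\<bar>\<sigma> * sqrt (D a \<gamma>)\<bar> < 1" using \<sigma> D D_less by auto
    then have pm: "0 < 1 + \<sigma> * sqrt (D a \<gamma>)" "1 + \<sigma> * sqrt (D a \<gamma>) < 2"
      by linarith+
    then have "0 < (1 + \<sigma> * sqrt (D a \<gamma>)) / (2 * e)" using e by simp
    then have "up < 0" and "up\<^sup>2 = (1 + \<sigma> * sqrt (D a \<gamma>)) / (2 * e)"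
      unfolding up by simp_all
    then have "2 * (up\<^sup>2 * e) - 1 = \<sigma> * sqrt (D a \<gamma>)" using e by (simp add: field_simps)
    moreover have "(\<sigma> * sqrt (D a \<gamma>))\<^sup>2 = D a \<gamma>"
      using \<sigma> D by auto
    ultimately show ?R
      unfolding iff using \<open>up < 0\<close> pm by auto
  next
    assume ?R
    then have up: "up < 0" and "up\<^sup>2 * e < 1" and D: "D a \<gamma> = (2 * (up\<^sup>2 * e) - 1)\<^sup>2"
      unfolding iff by auto
    have "\<bar>2 * (up\<^sup>2 * e) - 1\<bar> = sqrt (D a \<gamma>)" by (simp add: D)
    then obtain \<sigma> :: real where \<sigma>: "\<sigma> \<in> {1, - 1}" and "2 * (up\<^sup>2 * e) - 1 = \<sigma> * sqrt (D a \<gamma>)"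
      using that[of 1] that[of "- 1"] by (cases "0 \<le> 2 * (up\<^sup>2 * e) - 1") auto
    then have "(1 + \<sigma> * sqrt (D a \<gamma>)) / (2 * e) = up\<^sup>2" using e by (simp add: field_simps)
    then have "up = - sqrt ((1 + \<sigma> * sqrt (D a \<gamma>)) / (2 * e))" using up by simp
    then show "admissible_ratio \<gamma> up a"
      using \<sigma> True D unfolding admissible_ratio_def e_def by auto
  qed
qed (auto simp: admissible_ratio_def)

lemma admissible_ratio_unique:
  assumes "0 < \<gamma>" "admissible_ratio \<gamma> up a" "admissible_ratio \<gamma> up b"
  shows "a = b"
proof -
  have *: "\<not> a < b" if "admissible_ratio \<gamma> up a" "admissible_ratio \<gamma> up b" for a b
  proof
    assume "a < b"
    have A: "up < 0" "1 / 2 < a" "b < 1" "up\<^sup>2 * (1 - b + b\<^sup>2) < 1"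
        "\<gamma>\<^sup>2 = 9 / 2 * up\<^sup>2 * ratio_fun (up\<^sup>2) a" "\<gamma>\<^sup>2 = 9 / 2 * up\<^sup>2 * ratio_fun (up\<^sup>2) b"
      using that by (simp_all add: admissible_ratio_iff[OF \<open>0 < \<gamma>\<close>])
    then have "ratio_fun (up\<^sup>2) b < ratio_fun (up\<^sup>2) a"
      using \<open>a < b\<close> by (intro ratio_fun_less) auto
    with A show False by simp
  qed
  from *[OF assms(2,3)] *[OF assms(3,2)] show ?thesis by simp
qed

text \<open>
  The bounds are the two solutions for \<open>up\<close> of the quadratic equation at \<open>a = 1 / 2\<close>. Strict
  monotonicity in \<open>a\<close> turns that equation into a strict inequality, which says that \<open>up\<^sup>2\<close> lies
  strictly between its roots.
\<close>

lemma admissible_ratio_bounds: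
  assumes "0 < \<gamma>" "admissible_ratio \<gamma> up a"
  shows "- sqrt (2 / 3 * (1 + sqrt (1 - 8 * \<gamma>\<^sup>2 / 3))) < up"
    and "up < - sqrt (2 / 3 * (1 - sqrt (1 - 8 * \<gamma>\<^sup>2 / 3)))"
proof -
  have A: "up < 0" "1 / 2 < a" "a < 1" "up\<^sup>2 * (1 - a + a\<^sup>2) < 1"
      "\<gamma>\<^sup>2 = 9 / 2 * up\<^sup>2 * ratio_fun (up\<^sup>2) a"
    using assms by (simp_all add: admissible_ratio_iff)
  then have "ratio_fun (up\<^sup>2) a < ratio_fun (up\<^sup>2) (1 / 2)"
    by (intro ratio_fun_less) auto
  then have "\<gamma>\<^sup>2 < 9 / 2 * up\<^sup>2 * ratio_fun (up\<^sup>2) (1 / 2)"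
    using A by simp
  then have "(3 / 2 * up\<^sup>2 - 1)\<^sup>2 < 1 - 8 * \<gamma>\<^sup>2 / 3"
    by (simp add: ratio_fun_def power2_eq_square algebra_simps)
  then have "\<bar>3 / 2 * up\<^sup>2 - 1\<bar> < sqrt (1 - 8 * \<gamma>\<^sup>2 / 3)"
    using real_less_rsqrt[of "\<bar>3 / 2 * up\<^sup>2 - 1\<bar>"] by simp
  then have "2 / 3 * (1 - sqrt (1 - 8 * \<gamma>\<^sup>2 / 3)) < (- up)\<^sup>2"
    "(- up)\<^sup>2 < 2 / 3 * (1 + sqrt (1 - 8 * \<gamma>\<^sup>2 / 3))"
    by (auto simp: abs_less_iff)
  then show "- sqrt (2 / 3 * (1 + sqrt (1 - 8 * \<gamma>\<^sup>2 / 3))) < up"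
    "up < - sqrt (2 / 3 * (1 - sqrt (1 - 8 * \<gamma>\<^sup>2 / 3)))"
    using A(1) real_less_rsqrt[of "- up"] real_less_lsqrt[of "- up"] by fastforce+
qed

lemma admissible_ratio_of_connection:
  assumes "0 < \<gamma>" "0 < s" "0 < um" "saddle_saddle_connection \<gamma> s um up"
  shows "admissible_ratio \<gamma> up (um / - up)"
proof -
  note rel = saddle_saddle_connection_relation[OF assms]
  define a where "a = um / - up"
  have "up < 0" using rel(2) assms(3) by simp
  then have um: "um = - a * up" by (simp add: a_def)
  have s: "s = 1 - up\<^sup>2 * (1 - a + a\<^sup>2)"
    unfolding rel(1) um by (simp add: power2_eq_square algebra_simps)
  have "\<gamma> = 3 / sqrt 2 * (- up - um) * sqrt s"
    using rel(4) \<open>0 < s\<close> by (simp add: field_simps)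
  then have "\<gamma>\<^sup>2 = (3 / sqrt 2 * (- up - um) * sqrt s)\<^sup>2" by simp
  also have "\<dots> = 9 / 2 * (- up - um)\<^sup>2 * s"
    using \<open>0 < s\<close> unfolding power_mult_distrib power_divide by simp
  also have "- up - um = - up * (1 - a)" by (simp add: um algebra_simps)
  finally have "\<gamma>\<^sup>2 = 9 / 2 * up\<^sup>2 * ratio_fun (up\<^sup>2) a"
    unfolding s ratio_fun_def by (simp add: power_mult_distrib mult_ac)
  moreover have "1 / 2 < a" "a < 1"
    using rel(2,3) \<open>up < 0\<close> by (simp_all add: a_def field_simps)
  ultimately show ?thesis
    unfolding a_def[symmetric] admissible_ratio_iff[OF \<open>0 < \<gamma>\<close>]
    using \<open>up < 0\<close> \<open>0 < s\<close> s by simp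
qed

theorem theorem3p2:
  fixes \<gamma> um up :: real
  assumes "0 < \<gamma>" and "\<gamma> < sqrt (3 / 8)"
    and "0 < um"
    and "\<exists>s>0. saddle_saddle_connection \<gamma> s um up"
  shows "- sqrt (2 / 3 * (1 + sqrt (1 - 8 * \<gamma>\<^sup>2 / 3))) < up \<and>
         up < - sqrt (2 / 3 * (1 - sqrt (1 - 8 * \<gamma>\<^sup>2 / 3))) \<and>
         (\<exists>!a. admissible_ratio \<gamma> up a) \<and>
         (\<forall>a. admissible_ratio \<gamma> up a \<longrightarrow> um = - a * up)"
proof -
  have a: "admissible_ratio \<gamma> up (um / - up)"
    using assms admissible_ratio_of_connection by blast
  then have "up < 0" using \<open>0 < \<gamma>\<close> by (simp add: admissible_ratio_iff)
  have uniq: "b = um / - up" if "admissible_ratio \<gamma> up b" for b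
    using admissible_ratio_unique[OF \<open>0 < \<gamma>\<close> that a] .
  have "um = - b * up" if "admissible_ratio \<gamma> up b" for b
    using uniq[OF that] \<open>up < 0\<close> by simp
  with a uniq admissible_ratio_bounds[OF \<open>0 < \<gamma>\<close> a] show ?thesis by blast
qed

end
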